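(* Let $\mathcal{L}\subset\mathbb{R}^n$ be a lattice, $\vec t\in\mathbb{R}^n$, $s>0$, $\ell\ge 1$ and $M\ge 2$. Let $f$ be any (possibly randomized) function mapping a finite list of cosets $(\vec c_1,\dots,\vec c_M)$ modulo $2\mathcal{L}$ to a subset of indices $\{j_1,\dots,j_m\}\subseteq\{1,\dots,M\}$. Let $\mathcal{A}$ be the Reject-and-Average Sieve with rejection function $f$, and let $\mathcal{A}'$ be the same algorithm with $f$ replaced by the function that always outputs all indices (i.e., $\mathcal{A}'$ just applies Pair\_and\_Average $\ell$ times). If $\mathcal{A}$ and $\mathcal{A}'$ are each run on input $\ell$ and a list $\vec X_1,\dots,\vec X_M$ of independent samples from $D_{\mathcal{L}-\vec t,s}$, then both output distributions are mixtures of independent Gaussians over $\mathcal{L}-\vec t$ with parameter $s/2^{\ell/2}$, and the output distribution of $\mathcal{A}'$ dominates that of $\mathcal{A}$. In particular, for every finite set $S\subset\mathcal{L}-\vec t$, \[ \Pr[S\subseteq \mathcal{A}(\ell,\vec X_1,\dots,\vec X_M)] \le \Pr[S\subseteq\mathcal{A}'(\ell,\vec X_1,\dots,\vec X_M)]. \]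
   Context: A lattice $\mathcal{L}\subset\mathbb{R}^n$ is the set of integer combinations of $n$ linearly independent vectors. $\rho_s(\vec{x}) := \exp(-\pi\|\vec{x}\|^2/s^2)$, $\rho_s(A):=\sum_{\vec a\in A}\rho_s(\vec a)$, and $D_{A,s}$ is the distribution on the shifted lattice $A$ with probabilities $\rho_s(\vec a)/\rho_s(A)$. Pair\_and\_Average: given a list $\vec X_1,\dots,\vec X_M\in\mathcal{L}-\vec t$, for each still-unpaired $\vec X_i$ in order, if there is another unpaired $\vec X_j$ with $\vec X_j\equiv\vec X_i \bmod 2\mathcal{L}$, pair them and add $(\vec X_i+\vec X_j)/2$ to the output list. Reject-and-Average Sieve$(\ell;\vec X_1,\dots,\vec X_M)$: repeat $\ell$ times: let $\vec c_j$ be the coset of $\vec X_j$ mod $2\mathcal{L}$; compute $\{j_1,\dots,j_m\}\leftarrow f(\vec c_1,\dots,\vec c_M)$ (the randomness of $f$ depends only on the list of cosets); replace the list by Pair\_and\_Average$(\vec X_{j_1},\dots,\vec X_{j_m})$ and update $M$ to its length. Output the final list. Domination: for a finite set $S=\{1,\dots,N\}$ and random finite lists $(X_1,\dots,X_M)$, $(X'_1,\dots,X'_{M'})$ over $S$, the first dominates the second if for every $(k_1,\dots,k_N)\in\mathbb{N}^N$, $\Pr[|\{j: X_j=i\}|\ge k_i\ \forall i]\ge \Pr[|\{j: X'_j=i\}|\ge k_i\ \forall i]$. Mixture of independent Gaussians over $\mathcal{L}-\vec t$ with parameter $s$: a random finite list $(\vec X_1,\dots,\vec X_M)$ in $\mathcal{L}-\vec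 t$ such that for every list of cosets $(\vec c_1,\dots,\vec c_M)$ of $2\mathcal{L}$ in $\mathcal{L}-\vec t$, conditioned on $\vec X_i\in 2\mathcal{L}+\vec c_i$ for all $i$, the $\vec X_i$ are independent with $\vec X_i\sim D_{2\mathcal{L}+\vec c_i,s}$. Its coset distribution is $(2\mathcal{L}+\vec X_1,\dots,2\mathcal{L}+\vec X_M)$; one mixture dominates another if its coset distribution dominates the other's. *)

theory Defs
  imports "HOL-Probability.Probability"
begin

definition is_lattice :: "(real ^ 'n) set \<Rightarrow> bool" where
  "is_lattice L \<longleftrightarrow> (\<exists>B. independent B \<and> card B = CARD('n) \<and>
     L = {\<Sum>b\<in>B. of_int (z b) *\<^sub>R b | z :: real ^ 'n \<Rightarrow> int. True})"

definition shifted :: "(real ^ 'n) set \<Rightarrow> real ^ 'n \<Rightarrow> (real ^ 'n) set" where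
  "shifted L t = (\<lambda>y. y - t) ` L"

definition coset2 :: "(real ^ 'n) set \<Rightarrow> real ^ 'n \<Rightarrow> (real ^ 'n) set" where
  "coset2 L x = (\<lambda>y. 2 *\<^sub>R y + x) ` L"

definition cosets2 :: "(real ^ 'n) set \<Rightarrow> real ^ 'n \<Rightarrow> (real ^ 'n) set set" where
  "cosets2 L t = coset2 L ` shifted L t"

definition rho :: "real \<Rightarrow> real ^ 'n \<Rightarrow> real" where
  "rho s x = exp (- pi * (norm x)\<^sup>2 / s\<^sup>2)"

definition rho_set :: "real \<Rightarrow> (real ^ 'n) set \<Rightarrow> real" where
  "rho_set s A = (\<Sum>\<^sub>\<infinity>a\<in>A. rho s a)"

(* Meaningful when A is a shifted lattice and s > 0, so that the masses sum to 1. *)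
definition discrete_gaussian :: "(real ^ 'n) set \<Rightarrow> real \<Rightarrow> (real ^ 'n) pmf" where
  "discrete_gaussian A s = embed_pmf (\<lambda>x. if x \<in> A then rho s x / rho_set s A else 0)"

(* The argument is the list of vectors not yet processed and not yet paired; its head x is paired
   with the first later y in its coset. Vectors processed earlier and left unpaired need not be
   kept: being congruent mod 2L is symmetric, so none of them is congruent to x. *)
function pair_and_average :: "(real ^ 'n) set \<Rightarrow> (real ^ 'n) list \<Rightarrow> (real ^ 'n) list" where
  "pair_and_average L [] = []"
| "pair_and_average L (x # xs) =
     (case List.extract (\<lambda>y. y \<in> coset2 L x) xs of
        None \<Rightarrow> pair_and_average L xs
      | Some (ys, y, zs) \<Rightarrow> ((x + y) /\<^sub>R 2) # pair_and_average L (ys @ zs))"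
  by pat_completeness auto
termination
  by (relation "Wellfounded.measure (\<lambda>(L, xs). length xs)") (auto simp: extract_Some_iff)

(* Indices are 0-based; nths keeps the selected entries in their original order.
   The randomness of f is drawn afresh in every round. *)
primrec sieve :: "(real ^ 'n) set \<Rightarrow> ((real ^ 'n) set list \<Rightarrow> nat set pmf) \<Rightarrow> nat \<Rightarrow>
    (real ^ 'n) list \<Rightarrow> (real ^ 'n) list pmf" where
  "sieve L f 0 xs = return_pmf xs"
| "sieve L f (Suc l) xs =
     bind_pmf (f (map (coset2 L) xs)) (\<lambda>J. sieve L f l (pair_and_average L (nths xs J)))"

definition accept_all :: "(real ^ 'n) set list \<Rightarrow> nat set pmf" where
  "accept_all cs = return_pmf {..<length cs}"

definition rejection_function ::
    "(real ^ 'n) set \<Rightarrow> real ^ 'n \<Rightarrow> ((real ^ 'n) set list \<Rightarrow> nat set pmf) \<Rightarrow> bool" where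
  "rejection_function L t f \<longleftrightarrow>
     (\<forall>cs \<in> lists (cosets2 L t). \<forall>J \<in> set_pmf (f cs). J \<subseteq> {..<length cs})"

definition sieve_output :: "(real ^ 'n) set \<Rightarrow> real ^ 'n \<Rightarrow> real \<Rightarrow> nat \<Rightarrow>
    ((real ^ 'n) set list \<Rightarrow> nat set pmf) \<Rightarrow> nat \<Rightarrow> (real ^ 'n) list pmf" where
  "sieve_output L t s M f l =
     bind_pmf (replicate_pmf M (discrete_gaussian (shifted L t) s)) (sieve L f l)"

definition dominates :: "'b set \<Rightarrow> 'b list pmf \<Rightarrow> 'b list pmf \<Rightarrow> bool" where
  "dominates S p q \<longleftrightarrow> (\<forall>k :: 'b \<Rightarrow> nat.
     measure_pmf.prob p {xs. \<forall>i\<in>S. card {j. j < length xs \<and> xs ! j = i} \<ge> k i} \<ge>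
     measure_pmf.prob q {xs. \<forall>i\<in>S. card {j. j < length xs \<and> xs ! j = i} \<ge> k i})"

(* The condition on coset lists cs is vacuous for those of probability zero. *)
definition gaussian_mixture ::
    "(real ^ 'n) set \<Rightarrow> real ^ 'n \<Rightarrow> real \<Rightarrow> (real ^ 'n) list pmf \<Rightarrow> bool" where
  "gaussian_mixture L t s p \<longleftrightarrow>
     set_pmf p \<subseteq> lists (shifted L t) \<and>
     (\<forall>cs \<in> lists (cosets2 L t).
        let E = {xs. length xs = length cs \<and> (\<forall>i < length cs. xs ! i \<in> cs ! i)} in
        measure_pmf.prob p E > 0 \<longrightarrow>
        prob_space.indep_vars (measure_pmf (cond_pmf p E)) (\<lambda>_. count_space UNIV)
          (\<lambda>i xs. xs ! i) {..<length cs} \<and>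
        (\<forall>i < length cs. map_pmf (\<lambda>xs. xs ! i) (cond_pmf p E) = discrete_gaussian (cs ! i) s))"

definition coset_distribution ::
    "(real ^ 'n) set \<Rightarrow> (real ^ 'n) list pmf \<Rightarrow> (real ^ 'n) set list pmf" where
  "coset_distribution L p = map_pmf (map (coset2 L)) p"

(* For a lattice L the index set cosets2 L t is finite, with 2 ^ CARD('n) elements. *)
definition mixture_dominates ::
    "(real ^ 'n) set \<Rightarrow> real ^ 'n \<Rightarrow> (real ^ 'n) list pmf \<Rightarrow> (real ^ 'n) list pmf \<Rightarrow> bool" where
  "mixture_dominates L t p q \<longleftrightarrow>
     dominates (cosets2 L t) (coset_distribution L p) (coset_distribution L q)"

end

theory Submission imports Defs begin

text \<open>If \<open>X, Y\<close> are independent with distribution \<open>D\<close> on a coset of \<open>2L\<close>, the parallelogram identity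
  \<open>\<rho>\<^sub>s(X) \<rho>\<^sub>s(Y) = \<rho>\<^sub>r((X + Y)/2) \<rho>\<^sub>r((X - Y)/2)\<close> with \<open>r = s/\<surd>2\<close> shows that their average is a mixture of
  the discrete Gaussians of width \<open>r\<close> on the cosets of \<open>2L\<close>. Since the pairing depends on the cosets
  only, a run of the sieve can be simulated by first running a Markov chain on lists of cosets and
  drawing the Gaussian vectors independently at the very end.

  The order used in the definition of domination is not preserved by a single round: if there are
  two pairs, one in each of two cosets, with probability 1/2 and none otherwise, the pair counts
  dominate those of exactly one pair in a random one of the two cosets, but the second situation
  may be likelier to produce an output vector in a prescribed coset. What is preserved is the
  stronger relation given by a coupling in which one list is, as a multiset, contained in the
  other: halving the number of vectors in each coset is monotone, and further independent pairs
  only add further vectors. The coupling of the two outputs yields both domination and the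
  inequality for finite sets.\<close>

section \<open>Lists of independent samples\<close>

text \<open>Extends \<open>replicate_pmf\<close> to independent entries with individual laws; below,
  the parameters are cosets.\<close>

primrec list_pmf :: "('a \<Rightarrow> 'b pmf) \<Rightarrow> 'a list \<Rightarrow> 'b list pmf" where
  "list_pmf G [] = return_pmf []"
| "list_pmf G (c # cs) = bind_pmf (G c) (\<lambda>x. bind_pmf (list_pmf G cs) (\<lambda>xs. return_pmf (x # xs)))"

lemma list_pmf_append:
  "list_pmf G (cs @ ds) =
     bind_pmf (list_pmf G cs) (\<lambda>xs. bind_pmf (list_pmf G ds) (\<lambda>ys. return_pmf (xs @ ys)))"
  by (induction cs) (simp_all add: bind_return_pmf bind_return_pmf' bind_assoc_pmf)

lemma list_pmf_append_Cons:
  "list_pmf G (cs @ d # ds) =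
     bind_pmf (list_pmf G cs) (\<lambda>xs. bind_pmf (G d) (\<lambda>y. bind_pmf (list_pmf G ds)
       (\<lambda>ys. return_pmf (xs @ y # ys))))"
  by (simp add: list_pmf_append bind_assoc_pmf bind_return_pmf)

lemma replicate_pmf_eq_list_pmf: "replicate_pmf n p = list_pmf (\<lambda>_. p) (replicate n x)"
  by (induction n) simp_all

lemma list_pmf_cong: "(\<And>c. c \<in> set cs \<Longrightarrow> G c = H c) \<Longrightarrow> list_pmf G cs = list_pmf H cs"
  by (induction cs) (auto intro!: bind_pmf_cong)

text \<open>Independent draws commute, so a two-stage draw in every entry may perform all first
  stages before any second stage. This is what lets cosets be drawn before vectors.\<close>

lemma list_pmf_bind: "list_pmf (\<lambda>c. bind_pmf (K c) G) cs = bind_pmf (list_pmf K cs) (list_pmf G)"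
proof (induction cs)
  case (Cons c cs)
  have "list_pmf (\<lambda>c. bind_pmf (K c) G) (c # cs) =
    bind_pmf (K c) (\<lambda>d. bind_pmf (G d) (\<lambda>x. bind_pmf (list_pmf K cs)
      (\<lambda>ds. bind_pmf (list_pmf G ds) (\<lambda>xs. return_pmf (x # xs)))))"
    by (simp add: Cons bind_assoc_pmf)
  also have "\<dots> = bind_pmf (K c) (\<lambda>d. bind_pmf (list_pmf K cs) (\<lambda>ds. bind_pmf (G d)
      (\<lambda>x. bind_pmf (list_pmf G ds) (\<lambda>xs. return_pmf (x # xs)))))"
    by (subst bind_commute_pmf[of "G _"]) simp
  finally show ?case by (simp add: bind_assoc_pmf bind_return_pmf)
qed (simp add: bind_return_pmf)

lemma set_list_pmf: "set_pmf (list_pmf G cs) = {xs. list_all2 (\<lambda>x c. x \<in> set_pmf (G c)) xs cs}"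
  by (induction cs) (auto simp: list_all2_Cons2)

text \<open>The set \<open>J\<close> is fixed beforehand, so the discarded draws integrate out and
  the kept ones stay independent.\<close>

lemma map_nths_list_pmf: "map_pmf (\<lambda>xs. nths xs J) (list_pmf G cs) = list_pmf G (nths cs J)"
proof (induction cs arbitrary: J)
  case (Cons c cs)
  have "map_pmf (\<lambda>xs. nths xs J) (list_pmf G (c # cs)) =
     bind_pmf (G c) (\<lambda>x. map_pmf (\<lambda>ys. (if 0 \<in> J then [x] else []) @ ys)
       (map_pmf (\<lambda>xs. nths xs {j. Suc j \<in> J}) (list_pmf G cs)))"
    by (simp add: map_pmf_def bind_assoc_pmf bind_return_pmf nths_Cons)
  also have "\<dots> = list_pmf G (nths (c # cs) J)"
    unfolding Cons by (simp add: nths_Cons map_pmf_def bind_return_pmf')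
  finally show ?case .
qed simp

text \<open>The order of the entries is irrelevant for the comparison, so the coupling matches
  the head of the shorter list with any occurrence of the same parameter in the longer one.\<close>
lemma rel_list_pmf_mono:
  assumes "mset cs \<subseteq># mset ds"
  shows "rel_pmf (\<lambda>xs ys. mset xs \<subseteq># mset ys) (list_pmf G cs) (list_pmf G ds)"
  using assms
proof (induction cs arbitrary: ds)
  case Nil
  show ?case by (simp add: rel_pmf_return_pmf1)
next
  case (Cons c cs)
  let ?R = "\<lambda>xs ys. mset xs \<subseteq># mset ys"
  from Cons.prems have "c \<in> set ds" by (auto dest: mset_subset_eqD)
  then obtain us vs where ds: "ds = us @ c # vs" by (auto dest: split_list)
  \<comment> \<open>Keeping the parts around the matched entry as a pair allows the shared draw
    \<open>x\<close> to be inserted between them.\<close>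
  define Z where "Z = pair_pmf (list_pmf G us) (list_pmf G vs)"
  have "rel_pmf ?R (list_pmf G cs) (list_pmf G (us @ vs))"
    using Cons.prems by (intro Cons.IH) (simp add: ds)
  also have "list_pmf G (us @ vs) = map_pmf (\<lambda>(as, bs). as @ bs) Z"
    by (simp add: list_pmf_append Z_def pair_pmf_def map_pmf_def bind_assoc_pmf bind_return_pmf)
  finally have Z: "rel_pmf (\<lambda>xs (as, bs). mset xs \<subseteq># mset (as @ bs)) (list_pmf G cs) Z"
    by (simp add: pmf.rel_map case_prod_unfold)
  have eq: "list_pmf G ds = bind_pmf (G c) (\<lambda>x. bind_pmf Z (\<lambda>(as, bs). return_pmf (as @ x # bs)))"
    unfolding ds list_pmf_append_Cons Z_def pair_pmf_def bind_assoc_pmf bind_return_pmf prod.case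
    by (rule bind_commute_pmf)
  show ?case
    unfolding eq list_pmf.simps
    by (rule rel_pmf_bindI[OF rel_pmf_reflI[where P = "(=)"]], rule refl,
        hypsubst, rule rel_pmf_bindI[OF Z]) (auto split: prod.splits)
qed

text \<open>The events are indexed by position, since one parameter may occur several times; peeling
  off the head shifts the index.\<close>

lemma prob_list_pmf_prod:
  "measure_pmf.prob (list_pmf G cs) {xs. \<forall>i<length cs. xs ! i \<in> A i} =
     (\<Prod>i<length cs. measure_pmf.prob (G (cs ! i)) (A i))"
proof (induction cs arbitrary: A)
  case (Cons c cs)
  let ?E = "{xs. \<forall>i<length (c # cs). xs ! i \<in> A i}" and ?F = "{xs. \<forall>i<length cs. xs ! i \<in> A (Suc i)}"
  have ind: "indicator ?E (x # xs) = (indicator (A 0) x * indicator ?F xs :: ennreal)" for x xs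
    by (auto simp: indicator_def less_Suc_eq_0_disj)
  have "emeasure (list_pmf G (c # cs)) ?E = (\<integral>\<^sup>+xs. indicator ?E xs \<partial>list_pmf G (c # cs))"
    by simp
  also have "\<dots> = (\<integral>\<^sup>+x. \<integral>\<^sup>+xs. indicator ?E (x # xs) \<partial>list_pmf G cs \<partial>G c)"
    by simp
  also have "\<dots> = (\<integral>\<^sup>+x. \<integral>\<^sup>+xs. indicator (A 0) x * indicator ?F xs \<partial>list_pmf G cs \<partial>G c)"
    by (simp only: ind)
  also have "\<dots> = (\<integral>\<^sup>+x. indicator (A 0) x * emeasure (list_pmf G cs) ?F \<partial>G c)"
    by (simp add: nn_integral_cmult)
  also have "\<dots> = emeasure (G c) (A 0) * emeasure (list_pmf G cs) ?F"
    by (simp add: nn_integral_multc)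
  finally have "measure_pmf.prob (list_pmf G (c # cs)) ?E =
      measure_pmf.prob (G c) (A 0) * measure_pmf.prob (list_pmf G cs) ?F"
    by (simp add: measure_def enn2real_mult)
  then show ?case
    by (simp only: Cons.IH) (simp add: prod.lessThan_Suc_shift del: prod.lessThan_Suc)
qed simp

lemma map_nth_list_pmf:
  "i < length cs \<Longrightarrow> map_pmf (\<lambda>xs. xs ! i) (list_pmf G cs) = G (cs ! i)"
proof (induction cs arbitrary: i)
  case (Cons c cs)
  show ?case
  proof (cases i)
    case 0
    then show ?thesis by (simp add: map_bind_pmf bind_return_pmf')
  next
    case (Suc j)
    have "map_pmf (\<lambda>xs. xs ! i) (list_pmf G (c # cs)) = map_pmf (\<lambda>xs. xs ! j) (list_pmf G cs)"
      by (simp add: Suc map_bind_pmf) (simp add: map_pmf_def)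
    with Cons Suc show ?thesis by simp
  qed
qed simp

lemma indep_vars_list_pmf:
  "prob_space.indep_vars (measure_pmf (list_pmf G cs)) (\<lambda>_. count_space UNIV) (\<lambda>i xs. xs ! i)
     {..<length cs}"
\<comment> \<open>The finite criterion for independence used below asks for a nonempty index
  set.\<close>
proof (cases "cs = []")
  case True
  then show ?thesis
    by (simp add: prob_space.indep_vars_def[OF measure_pmf.prob_space_axioms]
        prob_space.indep_sets_def[OF measure_pmf.prob_space_axioms])
next
  case False
  have marginal: "measure_pmf.prob (list_pmf G cs) ((\<lambda>xs. xs ! j) -` B) = measure_pmf.prob (G (cs ! j)) B"
    if "j < length cs" for j B
    using that by (simp flip: measure_map_pmf add: map_nth_list_pmf)
  show ?thesis
  proof (subst prob_space.indep_vars_finite[OF measure_pmf.prob_space_axioms, where E = "\<lambda>_. UNIV"])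
    show "\<forall>A\<in>{..<length cs} \<rightarrow> UNIV.
        measure_pmf.prob (list_pmf G cs) (\<Inter>j\<in>{..<length cs}. (\<lambda>xs. xs ! j) -` A j \<inter> space (measure_pmf (list_pmf G cs))) =
        (\<Prod>j<length cs. measure_pmf.prob (list_pmf G cs) ((\<lambda>xs. xs ! j) -` A j \<inter> space (measure_pmf (list_pmf G cs))))"
    proof
      fix A :: "nat \<Rightarrow> 'a set"
      have "(\<Inter>j<length cs. (\<lambda>xs. xs ! j) -` A j) = {xs. \<forall>i<length cs. xs ! i \<in> A i}" by auto
      then show "measure_pmf.prob (list_pmf G cs)
          (\<Inter>j\<in>{..<length cs}. (\<lambda>xs. xs ! j) -` A j \<inter> space (measure_pmf (list_pmf G cs))) =
        (\<Prod>j<length cs. measure_pmf.prob (list_pmf G cs) ((\<lambda>xs. xs ! j) -` A j \<inter> space (measure_pmf (list_pmf G cs))))"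
        using False by (simp add: prob_list_pmf_prod marginal)
    qed
  qed (use False in \<open>auto simp: Int_stable_def\<close>)
qed

section \<open>Pairing\<close>

text \<open>The trace of \<open>pair_and_average\<close> on cosets: a pair is recorded by the common
  coset of its members, not by that of their average, which is still random.\<close>

function pairing :: "'a list \<Rightarrow> 'a list" where
  "pairing [] = []"
| "pairing (c # cs) = (if c \<in> set cs then c # pairing (remove1 c cs) else pairing cs)"
  by pat_completeness auto
termination
  by (relation "Wellfounded.measure length") (auto simp: length_remove1)

text \<open>Equal entries are paired only among themselves, and at most one of each kind stays
  single, so the counts do not depend on the order.\<close>

lemma count_pairing: "count (mset (pairing cs)) c = count (mset cs) c div 2"
proof (induction cs rule: pairing.induct)
  case (2 d cs)
  show ?case
  proof (cases "d \<in> set cs")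
    case True
    then obtain k where "count (mset cs) d = Suc k"
      by (metis Suc_pred count_greater_zero_iff set_mset_mset)
    with True 2(1) show ?thesis by auto
  next
    case False
    \<comment> \<open>Dropping the single \<open>d\<close> lowers its count from 1 to 0, and both
      halve to 0.\<close>
    then have "count (mset cs) d div 2 = 0" by (metis count_mset_0_iff div_0)
    with False 2(2) show ?thesis by (cases "c = d") auto
  qed
qed simp

lemma pairing_mono: "mset cs \<subseteq># mset ds \<Longrightarrow> mset (pairing cs) \<subseteq># mset (pairing ds)"
  by (auto simp: subseteq_mset_def count_pairing intro!: div_le_mono)

lemma set_pairing_subset: "set (pairing cs) \<subseteq> set cs"
  by (induction cs rule: pairing.induct) (auto split: if_splits dest: notin_set_remove1)

text \<open>The supports of \<open>G\<close> pin down the coset of every entry, so who is paired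
  with whom is already decided by \<open>cs\<close>. Each pair then contributes the average of two
  fresh draws from one \<open>G c\<close>, independently of the others.\<close>

lemma map_pair_and_average_list_pmf:
  fixes G :: "(real ^ 'n) set \<Rightarrow> (real ^ 'n) pmf"
  assumes coset: "\<And>x y. y \<in> coset2 L x \<longleftrightarrow> coset2 L y = coset2 L x"
    and supp: "\<And>c x. c \<in> set cs \<Longrightarrow> x \<in> set_pmf (G c) \<Longrightarrow> coset2 L x = c"
  shows "map_pmf (pair_and_average L) (list_pmf G cs) =
     list_pmf (\<lambda>c. bind_pmf (G c) (\<lambda>x. map_pmf (\<lambda>y. (x + y) /\<^sub>R 2) (G c))) (pairing cs)"
  using supp
proof (induction cs rule: pairing.induct)
  case (2 c cs)
  let ?A = "\<lambda>c. bind_pmf (G c) (\<lambda>x. map_pmf (\<lambda>y. (x + y) /\<^sub>R 2) (G c))"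
  have supp_nth: "map (coset2 L) xs = ds" if "xs \<in> set_pmf (list_pmf G ds)" "set ds \<subseteq> set (c # cs)" for xs ds
    using that by (induction ds arbitrary: xs) (auto simp: 2(3))
  show ?case
  proof (cases "c \<in> set cs")
    case False
    have "pair_and_average L (x # xs) = pair_and_average L xs"
      if "x \<in> set_pmf (G c)" "xs \<in> set_pmf (list_pmf G cs)" for x xs
    proof -
      have "coset2 L x = c" using that 2(3) by simp
      moreover have "map (coset2 L) xs = cs" using that by (intro supp_nth) auto
      ultimately have "List.extract (\<lambda>y. y \<in> coset2 L x) xs = None"
        using False unfolding extract_None_iff coset by (metis image_eqI list.set_map)
      then show ?thesis by simp
    qed
    then have "map_pmf (pair_and_average L) (list_pmf G (c # cs)) =
        bind_pmf (G c) (\<lambda>_. map_pmf (pair_and_average L) (list_pmf G cs))"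
      unfolding list_pmf.simps map_bind_pmf map_return_pmf
      by (intro bind_pmf_cong) (auto simp: map_pmf_def intro!: bind_pmf_cong)
    with False 2 show ?thesis by simp
  next
    case True
    \<comment> \<open>Splitting at the first \<open>c\<close> identifies the partner: no entry drawn
      for \<open>us\<close> can match, so \<open>List.extract\<close> stops exactly at
      \<open>y\<close>.\<close>
    then obtain us vs where cs: "cs = us @ c # vs" "c \<notin> set us" by (auto dest: split_list_first)
    have step: "pair_and_average L (x # as @ y # bs) = ((x + y) /\<^sub>R 2) # pair_and_average L (as @ bs)"
      if "x \<in> set_pmf (G c)" "as \<in> set_pmf (list_pmf G us)" "y \<in> set_pmf (G c)" for x as y bs
    proof -
      have "coset2 L x = c" "coset2 L y = c" using that 2(3) by simp_all
      moreover have "map (coset2 L) as = us" using that by (intro supp_nth) (auto simp: cs)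
      then have "coset2 L z \<noteq> c" if "z \<in> set as" for z using cs(2) that by auto
      ultimately have "List.extract (\<lambda>y. y \<in> coset2 L x) (as @ y # bs) = Some (as, y, bs)"
        unfolding extract_Some_iff coset by auto
      then show ?thesis by simp
    qed
    have IH: "map_pmf (pair_and_average L) (list_pmf G (us @ vs)) = list_pmf ?A (pairing (us @ vs))"
      using 2(1)[OF True] 2(3) by (simp add: cs remove1_append)
    have "map_pmf (pair_and_average L) (list_pmf G (c # cs)) =
        bind_pmf (G c) (\<lambda>x. bind_pmf (list_pmf G us) (\<lambda>as. bind_pmf (G c) (\<lambda>y.
          bind_pmf (list_pmf G vs) (\<lambda>bs. return_pmf (pair_and_average L (x # as @ y # bs))))))"
      by (simp only: cs list_pmf.simps list_pmf_append_Cons map_bind_pmf bind_assoc_pmf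
            bind_return_pmf map_return_pmf)
    also have "\<dots> = bind_pmf (G c) (\<lambda>x. bind_pmf (list_pmf G us) (\<lambda>as. bind_pmf (G c) (\<lambda>y.
          bind_pmf (list_pmf G vs) (\<lambda>bs. return_pmf (((x + y) /\<^sub>R 2) # pair_and_average L (as @ bs))))))"
      by (intro bind_pmf_cong refl) (simp only: step)
    also have "\<dots> = bind_pmf (G c) (\<lambda>x. bind_pmf (G c) (\<lambda>y. bind_pmf (list_pmf G us) (\<lambda>as. 
          bind_pmf (list_pmf G vs) (\<lambda>bs. return_pmf (((x + y) /\<^sub>R 2) # pair_and_average L (as @ bs))))))"
      by (subst bind_commute_pmf[of "list_pmf G us"]) simp
    also have "\<dots> = bind_pmf (?A c) (\<lambda>z. bind_pmf (map_pmf (pair_and_average L) (list_pmf G (us @ vs)))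
        (\<lambda>zs. return_pmf (z # zs)))"
      by (simp add: map_pmf_def list_pmf_append bind_assoc_pmf bind_return_pmf)
    also have "\<dots> = list_pmf ?A (pairing (c # cs))"
      using True by (simp add: IH cs remove1_append)
    finally show ?thesis .
  qed
qed simp

section \<open>Discrete Gaussians on lattice cosets\<close>

text \<open>The product rule over \<open>PiE\<close> and the integral formula for the total mass are
  phrased with the first notion, everything else with the second.\<close>

lemma set_sum_abs_summable_on_iff_real:
  fixes f :: "'a \<Rightarrow> real"
  shows "Infinite_Set_Sum.abs_summable_on f A \<longleftrightarrow> f summable_on A"
  by (rule trans[OF abs_summable_equivalent[symmetric] summable_on_iff_abs_summable_on_real[symmetric]])

text \<open>Two geometric series, over the nonnegative and the nonpositive integers, overlapping in
  0.\<close>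

lemma summable_on_exp_neg_abs_int:
  assumes "\<alpha> > 0"
  shows "(\<lambda>z::int. exp (- \<alpha> * real_of_int \<bar>z\<bar>)) summable_on UNIV"
proof -
  let ?e = "\<lambda>z::int. exp (- \<alpha> * real_of_int \<bar>z\<bar>)"
  have "(\<lambda>n::nat. exp (- \<alpha>) ^ n) summable_on UNIV"
    using assms by (subst summable_on_UNIV_nonneg_real_iff) (auto intro: summable_geometric)
  then have nat: "(\<lambda>n::nat. exp (- \<alpha> * real n)) summable_on UNIV"
    by (simp add: exp_of_nat_mult[symmetric] mult.commute)
  have "?e summable_on range int" "?e summable_on range (\<lambda>n. - int n)"
    using nat by (subst summable_on_reindex; simp add: inj_on_def o_def)+
  then have "?e summable_on (range int \<union> range (\<lambda>n. - int n))"
    by (rule summable_on_union)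
  moreover have "range int \<union> range (\<lambda>n. - int n) = UNIV"
  proof -
    have "z \<in> range int \<union> range (\<lambda>n. - int n)" for z
      by (cases z rule: int_cases2) auto
    then show ?thesis by auto
  qed
  ultimately show ?thesis by simp
qed

text \<open>The exponential factorises over \<open>B\<close>, which reduces the claim to
  one-dimensional sums.\<close>

lemma summable_on_exp_neg_sum_abs:
  assumes "finite B" "\<alpha> > 0"
  shows "(\<lambda>z. exp (- \<alpha> * (\<Sum>b\<in>B. real_of_int \<bar>z b\<bar>))) summable_on (B \<rightarrow>\<^sub>E (UNIV :: int set))"
proof -
  have "Infinite_Set_Sum.abs_summable_on (\<lambda>z. \<Prod>b\<in>B. exp (- \<alpha> * real_of_int \<bar>z b\<bar>)) (B \<rightarrow>\<^sub>E (UNIV :: int set))"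
    using summable_on_exp_neg_abs_int[OF assms(2)]
    by (intro Infinite_Set_Sum.abs_summable_on_prod_PiE assms)
       (simp_all add: set_sum_abs_summable_on_iff_real)
  then have "(\<lambda>z. \<Prod>b\<in>B. exp (- \<alpha> * real_of_int \<bar>z b\<bar>)) summable_on (B \<rightarrow>\<^sub>E (UNIV :: int set))"
    by (simp add: set_sum_abs_summable_on_iff_real)
  then show ?thesis
    by (simp add: sum_distrib_left exp_sum assms)
qed

text \<open>The dual functionals of a basis read off integer coordinates and are bounded, so
  coordinates grow at most linearly with the norm. This turns sums over \<open>L\<close> into sums
  over integer vectors.\<close>

lemma lattice_coordinates:
  fixes L :: "(real ^ 'n) set"
  assumes "is_lattice L"
  obtains B :: "(real ^ 'n) set" and Z :: "real ^ 'n \<Rightarrow> real ^ 'n \<Rightarrow> int" and K :: real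
  where "finite B" "inj_on Z L" "Z ` L \<subseteq> B \<rightarrow>\<^sub>E UNIV" "K > 0"
    "\<And>x. x \<in> L \<Longrightarrow> (\<Sum>b\<in>B. real_of_int \<bar>Z x b\<bar>) \<le> K * norm x"
proof -
  obtain B where B: "independent B"
    and L: "L = {\<Sum>b\<in>B. of_int (z b) *\<^sub>R b | z :: real ^ 'n \<Rightarrow> int. True}"
    using assms by (auto simp: is_lattice_def)
  have fin: "finite B" using B by (rule independent_imp_finite)
  have "\<exists>g. linear g \<and> (\<forall>x\<in>B. g x = (if x = b then 1 else 0 :: real))" for b
    by (rule linear_independent_extend[OF B])
  then obtain g :: "real ^ 'n \<Rightarrow> real ^ 'n \<Rightarrow> real"
    where g: "linear (g b)" "x \<in> B \<Longrightarrow> g b x = (if x = b then 1 else 0)" for b x by metis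
  have "\<exists>k>0. \<forall>x. norm (g b x) \<le> norm x * k" for b
    using g(1) by (intro bounded_linear.pos_bounded) (simp add: linear_conv_bounded_linear)
  then obtain k where k: "k b > 0" "norm (g b x) \<le> norm x * k b" for b x by metis
  \<comment> \<open>On \<open>L\<close> the value \<open>g b x\<close> is already an integer, so the
    floor only changes the type; \<open>restrict\<close> puts \<open>Z x\<close> into the
    extensional function space.\<close>
  define Z where "Z x = restrict (\<lambda>b. \<lfloor>g b x\<rfloor>) B" for x
  have g_sum: "g b (\<Sum>a\<in>B. of_int (z a) *\<^sub>R a) = of_int (z b)" if "b \<in> B" for b and z :: "real ^ 'n \<Rightarrow> int"
    using that fin
    by (simp add: linear_sum[OF g(1)] linear_cmul[OF g(1)] g(2) if_distrib sum.delta cong: if_cong)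
  have Z: "real_of_int (Z x b) = g b x" if "x \<in> L" "b \<in> B" for x b
    using that by (auto simp: L Z_def g_sum)
  have repr: "x = (\<Sum>b\<in>B. of_int (Z x b) *\<^sub>R b)" if "x \<in> L" for x
    using that by (auto simp: L Z_def g_sum)
  show thesis
  \<comment> \<open>The added 1 makes the constant positive whatever \<open>B\<close> is.\<close>
  proof (rule that[of B Z "1 + sum k B"])
    show "inj_on Z L" by (rule inj_onI) (metis repr)
    show "1 + sum k B > 0" using k(1) by (intro add_pos_nonneg sum_nonneg) (auto intro: less_imp_le)
    show "(\<Sum>b\<in>B. real_of_int \<bar>Z x b\<bar>) \<le> (1 + sum k B) * norm x" if "x \<in> L" for x
    proof -
      have "(\<Sum>b\<in>B. real_of_int \<bar>Z x b\<bar>) \<le> (\<Sum>b\<in>B. norm x * k b)"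
        using Z[OF that] k(2) by (intro sum_mono) (simp add: of_int_abs)
      also have "\<dots> = sum k B * norm x" by (simp add: sum_distrib_left mult.commute)
      finally show ?thesis by (simp add: algebra_simps add_increasing)
    qed
    show "finite B" by (rule fin)
    show "Z ` L \<subseteq> B \<rightarrow>\<^sub>E UNIV" by (rule image_subsetI) (simp add: Z_def)
  qed
qed

lemma rho_summable_on_shifted:
  fixes L :: "(real ^ 'n) set"
  assumes "is_lattice L" "s > 0"
  shows "rho s summable_on shifted L t"
proof -
  obtain B :: "(real ^ 'n) set" and Z K where B: "finite B" "inj_on Z L" "Z ` L \<subseteq> B \<rightarrow>\<^sub>E (UNIV :: int set)" "K > 0"
    "\<And>x. x \<in> L \<Longrightarrow> (\<Sum>b\<in>B. real_of_int \<bar>Z x b\<bar>) \<le> K * norm x"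
    using lattice_coordinates[OF assms(1)] by metis
  define a where "a = pi / s\<^sup>2"
  have a: "a > 0" using assms by (simp add: a_def)
  \<comment> \<open>With \<open>r = norm (x - t)\<close>, the bound \<open>r^2 >= 2 * r - 1\<close>
    yields the factor \<open>exp a\<close> and the slope \<open>2 * a\<close>; the triangle
    inequality costs \<open>2 * a * norm t\<close>, and \<open>K\<close> converts norms to
    coordinates.\<close>
  define e where "e z = exp (a + 2 * a * norm t) * exp (- (2 * a / K) * (\<Sum>b\<in>B. real_of_int \<bar>z b\<bar>))"
    for z :: "real ^ 'n \<Rightarrow> int"
  have "e summable_on (B \<rightarrow>\<^sub>E UNIV)"
    unfolding e_def using a B by (intro summable_on_cmult_right summable_on_exp_neg_sum_abs) auto
  then have "e summable_on (Z ` L)"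
    using B(3) by (rule summable_on_subset)
  then have "(e \<circ> Z) summable_on L"
    using B(2) by (simp add: summable_on_reindex)
  moreover have "rho s (x - t) \<le> (e \<circ> Z) x" if "x \<in> L" for x
  proof -
    have "norm x \<le> norm (x - t) + norm t"
      using norm_triangle_ineq[of "x - t" t] by simp
    moreover have "(1 / K) * (\<Sum>b\<in>B. real_of_int \<bar>Z x b\<bar>) \<le> norm x"
      using B(4,5) that by (simp add: field_simps)
    ultimately have "(1 / K) * (\<Sum>b\<in>B. real_of_int \<bar>Z x b\<bar>) - norm t \<le> norm (x - t)" by linarith
    then have "2 * a * ((1 / K) * (\<Sum>b\<in>B. real_of_int \<bar>Z x b\<bar>) - norm t) \<le> 2 * a * norm (x - t)"
      using a by (intro mult_left_mono) auto
    moreover have "a * (2 * norm (x - t) - 1) \<le> a * (norm (x - t))\<^sup>2"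
      using a sum_squares_ge_zero[of "norm (x - t) - 1" 0]
      by (intro mult_left_mono) (auto simp: power2_eq_square algebra_simps)
    ultimately have "- a * (norm (x - t))\<^sup>2 \<le> a + 2 * a * norm t + - (2 * a / K) * (\<Sum>b\<in>B. real_of_int \<bar>Z x b\<bar>)"
      by (simp add: algebra_simps)
    then show ?thesis by (simp add: rho_def e_def a_def exp_add[symmetric])
  qed
  ultimately have "(\<lambda>x. rho s (x - t)) summable_on L"
    by (rule summable_on_comparison_test) (auto simp: rho_def)
  then show ?thesis
    by (simp add: shifted_def summable_on_reindex inj_on_def o_def)
qed

lemma lattice_closed:
  fixes L :: "(real ^ 'n) set"
  assumes "is_lattice L"
  shows "0 \<in> L" "x \<in> L \<Longrightarrow> y \<in> L \<Longrightarrow> x + y \<in> L" "x \<in> L \<Longrightarrow> - x \<in> L" "x \<in> L \<Longrightarrow> y \<in> L \<Longrightarrow> x - y \<in> L"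
proof -
  obtain B where L: "L = {\<Sum>b\<in>B. of_int (z b) *\<^sub>R b | z :: real ^ 'n \<Rightarrow> int. True}"
    using assms by (auto simp: is_lattice_def)
  have mem: "(\<Sum>b\<in>B. of_int (z b) *\<^sub>R b) \<in> L" for z :: "real ^ 'n \<Rightarrow> int" by (auto simp: L)
  show "0 \<in> L" using mem[of "\<lambda>_. 0"] by simp
  show *: "x + y \<in> L" if xy: "x \<in> L" "y \<in> L" for x y
  proof -
    obtain z w where "x = (\<Sum>b\<in>B. of_int (z b) *\<^sub>R b)" "y = (\<Sum>b\<in>B. of_int (w b) *\<^sub>R b)"
      using xy by (auto simp: L)
    then show ?thesis using mem[of "\<lambda>b. z b + w b"] by (simp add: scaleR_add_left sum.distrib)
  qed
  show **: "- x \<in> L" if x: "x \<in> L" for x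
  proof -
    obtain z where "x = (\<Sum>b\<in>B. of_int (z b) *\<^sub>R b)" using x by (auto simp: L)
    then show ?thesis using mem[of "\<lambda>b. - z b"] by (simp add: sum_negf)
  qed
  show "x - y \<in> L" if "x \<in> L" "y \<in> L" using *[OF that(1) **[OF that(2)]] by simp
qed

section \<open>Discrete Gaussians as probability laws on cosets\<close>

lemma rho_pos: "rho s x > 0"
  by (simp add: rho_def)

text \<open>\<open>embed_pmf\<close> has the intended density once the masses sum to 1; summability
  makes the normaliser the true total mass and nonemptiness makes it positive.\<close>

lemma pmf_discrete_gaussian:
  assumes "rho s summable_on A" "A \<noteq> {}"
  shows "pmf (discrete_gaussian A s) x = (if x \<in> A then rho s x / rho_set s A else 0)"
    and "rho_set s A > 0"
proof -
  have abs: "Infinite_Set_Sum.abs_summable_on (rho s) A"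
    using assms(1) by (simp add: set_sum_abs_summable_on_iff_real)
  obtain a where a: "a \<in> A" using assms(2) by blast
  have "rho s a \<le> rho_set s A"
    using infsum_mono_neutral[of "rho s" "{a}" "rho s" A] a assms(1)
    by (simp add: rho_set_def rho_pos less_imp_le)
  then show pos: "rho_set s A > 0"
    using rho_pos[of s a] by linarith
  have "(\<integral>\<^sup>+x. ennreal (if x \<in> A then rho s x / rho_set s A else 0) \<partial>count_space UNIV) =
    (\<integral>\<^sup>+x. ennreal (rho s x) * ennreal (1 / rho_set s A) * indicator A x \<partial>count_space UNIV)"
    using pos by (intro nn_integral_cong) (auto simp: indicator_def ennreal_mult[symmetric] rho_pos less_imp_le)
  also have "\<dots> = (\<integral>\<^sup>+x. ennreal (rho s x) * ennreal (1 / rho_set s A) \<partial>count_space A)"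
    by (simp add: nn_integral_count_space_indicator)
  also have "\<dots> = (\<integral>\<^sup>+x. ennreal (rho s x) \<partial>count_space A) * ennreal (1 / rho_set s A)"
    by (rule nn_integral_multc) simp
  also have "\<dots> = ennreal (rho_set s A) * ennreal (1 / rho_set s A)"
    using abs
    by (simp add: nn_integral_conv_infsetsum rho_pos less_imp_le rho_set_def infsetsum_infsum)
  also have "\<dots> = 1" using pos by (simp add: ennreal_mult[symmetric])
  finally show "pmf (discrete_gaussian A s) x = (if x \<in> A then rho s x / rho_set s A else 0)"
    unfolding discrete_gaussian_def using pos
    by (intro pmf_embed_pmf) (auto simp: rho_pos less_imp_le)
qed

lemma set_discrete_gaussian:
  assumes "rho s summable_on A" "A \<noteq> {}"
  shows "set_pmf (discrete_gaussian A s) = A"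
proof (rule set_eqI)
  fix x
  show "x \<in> set_pmf (discrete_gaussian A s) \<longleftrightarrow> x \<in> A"
    unfolding set_pmf_iff pmf_discrete_gaussian(1)[OF assms]
    using pmf_discrete_gaussian(2)[OF assms] rho_pos[of s x] by simp
qed

lemma coset2_eq_iff:
  assumes "is_lattice L"
  shows "y \<in> coset2 L x \<longleftrightarrow> coset2 L y = coset2 L x"
proof
  assume "y \<in> coset2 L x"
  then obtain w where w: "w \<in> L" "y = 2 *\<^sub>R w + x" by (auto simp: coset2_def)
  show "coset2 L y = coset2 L x"
  proof (intro equalityI subsetI)
    fix v assume "v \<in> coset2 L y"
    then obtain u where "u \<in> L" "v = 2 *\<^sub>R (u + w) + x"
      by (auto simp: coset2_def w scaleR_add_right add.assoc)
    then show "v \<in> coset2 L x" using lattice_closed(2)[OF assms, of u w] w by (auto simp: coset2_def)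
  next
    fix v assume "v \<in> coset2 L x"
    then obtain u where "u \<in> L" "v = 2 *\<^sub>R (u - w) + y"
      by (auto simp: coset2_def w scaleR_diff_right)
    then show "v \<in> coset2 L y" using lattice_closed(4)[OF assms, of u w] w by (auto simp: coset2_def)
  qed
next
  assume "coset2 L y = coset2 L x"
  moreover have "y \<in> coset2 L y"
    using lattice_closed(1)[OF assms] by (force simp: coset2_def)
  ultimately show "y \<in> coset2 L x" by simp
qed

lemma coset2_self: "is_lattice L \<Longrightarrow> x \<in> coset2 L x"
  by (simp add: coset2_eq_iff)

lemma coset2_subset_shifted:
  assumes "is_lattice L" "x \<in> shifted L t"
  shows "coset2 L x \<subseteq> shifted L t"
proof
  fix y assume "y \<in> coset2 L x"
  then obtain w where w: "w \<in> L" "y = 2 *\<^sub>R w + x" by (auto simp: coset2_def)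
  obtain v where v: "v \<in> L" "x = v - t" using assms(2) by (auto simp: shifted_def)
  have "w + w + v \<in> L" by (intro lattice_closed assms w v)
  moreover have "y = (w + w + v) - t" by (simp add: w v scaleR_2)
  ultimately show "y \<in> shifted L t" unfolding shifted_def by blast
qed

lemma discrete_gaussian_coset:
  assumes L: "is_lattice L" "s > 0" and c: "c \<in> cosets2 L t"
  shows "pmf (discrete_gaussian c s) x = (if x \<in> c then rho s x / rho_set s c else 0)"
    and "rho_set s c > 0" and "set_pmf (discrete_gaussian c s) = c"
    and "x \<in> c \<longleftrightarrow> coset2 L x = c" and "c \<subseteq> shifted L t"
proof -
  obtain x0 where x0: "x0 \<in> shifted L t" "c = coset2 L x0" using c by (auto simp: cosets2_def)
  have ne: "c \<noteq> {}" using coset2_self[OF L(1)] x0 by blast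
  show sub: "c \<subseteq> shifted L t" using coset2_subset_shifted[OF L(1) x0(1)] x0(2) by simp
  have sm: "rho s summable_on c" by (rule summable_on_subset[OF rho_summable_on_shifted[OF L] sub])
  show "pmf (discrete_gaussian c s) x = (if x \<in> c then rho s x / rho_set s c else 0)"
    "rho_set s c > 0" by (rule pmf_discrete_gaussian[OF sm ne])+
  show "set_pmf (discrete_gaussian c s) = c" by (rule set_discrete_gaussian[OF sm ne])
  show "x \<in> c \<longleftrightarrow> coset2 L x = c" by (simp add: x0(2) coset2_eq_iff[OF L(1)])
qed

text \<open>The ratio condition says that \<open>p\<close> is proportional to \<open>rho s\<close>
  within each coset, so conditioning on the coset leaves its discrete Gaussian. This serves both the
  input law and the averages of pairs.\<close>

lemma pmf_eq_mixture_of_cosets: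
  assumes L: "is_lattice L" "s > 0" and supp: "set_pmf p \<subseteq> shifted L t"
    and ratio: "\<And>u v. coset2 L u = coset2 L v \<Longrightarrow> pmf p u * rho s v = pmf p v * rho s u"
  shows "p = bind_pmf (map_pmf (coset2 L) p) (\<lambda>c. discrete_gaussian c s)"
proof (rule pmf_eqI)
  fix u
  let ?c = "coset2 L u"
  have cos: "c \<in> cosets2 L t" if "c \<in> set_pmf (map_pmf (coset2 L) p)" for c
    using that supp by (auto simp: cosets2_def)
  have "pmf (bind_pmf (map_pmf (coset2 L) p) (\<lambda>c. discrete_gaussian c s)) u =
    (\<integral>c. pmf (discrete_gaussian c s) u \<partial>map_pmf (coset2 L) p)"
    by (rule pmf_bind)
  \<comment> \<open>Cosets are disjoint, so only that of \<open>u\<close> contributes to the mass at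
    \<open>u\<close>.\<close>
  also have "\<dots> = (\<Sum>c\<in>{?c}. pmf (discrete_gaussian c s) u * pmf (map_pmf (coset2 L) p) c)"
  proof (rule integral_measure_pmf_real)
    fix c assume c: "c \<in> set_pmf (map_pmf (coset2 L) p)" "pmf (discrete_gaussian c s) u \<noteq> 0"
    then have "u \<in> c" using discrete_gaussian_coset(1)[OF L cos[OF c(1)], of u] by (auto split: if_splits)
    then show "c \<in> {?c}" using discrete_gaussian_coset(4)[OF L cos[OF c(1)], of u] by simp
  qed simp
  also have "\<dots> = pmf p u"
  proof (cases "u \<in> shifted L t")
    case False
    have "?c \<notin> set_pmf (map_pmf (coset2 L) p)"
    proof
      assume "?c \<in> set_pmf (map_pmf (coset2 L) p)"
      from discrete_gaussian_coset(5)[OF L cos[OF this]] coset2_self[OF L(1), of u] False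
      show False by blast
    qed
    moreover have "u \<notin> set_pmf p" using False supp by blast
    ultimately have "pmf p u = 0" "pmf (map_pmf (coset2 L) p) ?c = 0"
      by (simp_all only: pmf_eq_0_set_pmf not_True_eq_False not_False_eq_True)
    then show ?thesis by simp
  next
    case True
    then have c: "?c \<in> cosets2 L t" by (simp add: cosets2_def)
    note G = discrete_gaussian_coset[OF L c]
    have u: "u \<in> ?c" by (rule coset2_self[OF L(1)])
    have "ennreal (pmf (map_pmf (coset2 L) p) ?c) = emeasure p ?c"
    proof -
      have "coset2 L -` {?c} = ?c" using G(4) by auto
      then show ?thesis by (simp add: pmf_map measure_pmf.emeasure_eq_measure)
    qed
    also have "\<dots> = (\<integral>\<^sup>+v. pmf p v \<partial>count_space ?c)"
      by (simp add: nn_integral_pmf)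
    \<comment> \<open>The ratio condition, anchored at \<open>u\<close>, expresses \<open>p\<close>
      on the coset as a constant multiple of the discrete Gaussian; the latter has mass 1, so the
      constant is the mass of the coset.\<close>
    also have "\<dots> = (\<integral>\<^sup>+v. ennreal (pmf p u * rho_set s ?c / rho s u) * pmf (discrete_gaussian ?c s) v \<partial>count_space ?c)"
    proof (rule nn_integral_cong)
      fix v assume "v \<in> space (count_space ?c)"
      then have v: "v \<in> ?c" by simp
      then have "pmf p u * rho s v = pmf p v * rho s u" using G(4) by (intro ratio) simp
      then have "pmf p v = (pmf p u * rho_set s ?c / rho s u) * pmf (discrete_gaussian ?c s) v"
        using v G(2) rho_pos[of s u] by (simp add: G(1) field_simps)
      moreover have "pmf p u * rho_set s ?c / rho s u \<ge> 0"
        using G(2) rho_pos[of s u] by simp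
      ultimately show "ennreal (pmf p v) = ennreal (pmf p u * rho_set s ?c / rho s u) * pmf (discrete_gaussian ?c s) v"
        by (simp only: ennreal_mult pmf_nonneg)
    qed
    also have "\<dots> = ennreal (pmf p u * rho_set s ?c / rho s u) * emeasure (discrete_gaussian ?c s) ?c"
      by (subst nn_integral_cmult) (simp_all add: nn_integral_pmf)
    also have "emeasure (discrete_gaussian ?c s) ?c = 1"
      by (metis G(3) emeasure_pmf)
    finally have "pmf (map_pmf (coset2 L) p) ?c = pmf p u * rho_set s ?c / rho s u"
      using G(2) rho_pos[of s u] by simp
    then show ?thesis using u G(1)[of u] G(2) rho_pos[of s u] by simp
  qed
  finally show "pmf p u = pmf (bind_pmf (map_pmf (coset2 L) p) (\<lambda>c. discrete_gaussian c s)) u" by simp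
qed

section \<open>Averages of two Gaussian vectors from one coset\<close>

definition gaussian_average :: "(real ^ 'n) set \<Rightarrow> real \<Rightarrow> (real ^ 'n) pmf" where
  "gaussian_average c s = bind_pmf (discrete_gaussian c s)
     (\<lambda>x. map_pmf (\<lambda>y. (x + y) /\<^sub>R 2) (discrete_gaussian c s))"

text \<open>The vector \<open>2 *\<^sub>R u - x\<close> is the partner of \<open>x\<close> with
  average \<open>u\<close>, and \<open>x - u\<close> is half their difference. The factor 2 in the
  parallelogram law is absorbed by the width \<open>s / sqrt 2\<close>.\<close>

lemma rho_parallelogram:
  "rho s x * rho s (2 *\<^sub>R u - x) = rho (s / sqrt 2) u * rho (s / sqrt 2) (x - u)"
proof -
  have "(norm x)\<^sup>2 + (norm (2 *\<^sub>R u - x))\<^sup>2 = 2 * (norm u)\<^sup>2 + 2 * (norm (x - u))\<^sup>2"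
    by (simp add: power2_norm_eq_inner algebra_simps inner_commute)
  then have "pi * ((norm x)\<^sup>2 + (norm (2 *\<^sub>R u - x))\<^sup>2) / s\<^sup>2 = pi * (2 * (norm u)\<^sup>2 + 2 * (norm (x - u))\<^sup>2) / s\<^sup>2"
    by simp
  then show ?thesis
    by (simp add: rho_def exp_add[symmetric] power_divide add_divide_distrib distrib_left mult.left_commute mult.commute)
qed

text \<open>Once \<open>x\<close> is drawn, exactly one partner produces the average
  \<open>u\<close>. Integrating over the whole space rather than over \<open>c\<close> makes
  translations available as bijections.\<close>

lemma pmf_gaussian_average:
  fixes u :: "real ^ 'n"
  shows "ennreal (pmf (gaussian_average c s) u) = (\<integral>\<^sup>+x. ennreal (pmf (discrete_gaussian c s) x) *
     ennreal (pmf (discrete_gaussian c s) (2 *\<^sub>R u - x)) \<partial>count_space UNIV)"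
proof -
  have "pmf (map_pmf (\<lambda>y. (x + y) /\<^sub>R 2) G) u = pmf G (2 *\<^sub>R u - x)"
    for x and G :: "(real ^ 'n) pmf"
  proof -
    have "inj (\<lambda>y. (x + y) /\<^sub>R 2)" by (rule injI) simp
    then have "pmf (map_pmf (\<lambda>y. (x + y) /\<^sub>R 2) G) ((x + (2 *\<^sub>R u - x)) /\<^sub>R 2) = pmf G (2 *\<^sub>R u - x)"
      by (rule pmf_map_inj')
    then show ?thesis by simp
  qed
  then show ?thesis
    unfolding gaussian_average_def ennreal_pmf_bind nn_integral_measure_pmf by (simp only:)
qed

text \<open>By the parallelogram identity, the mass at \<open>u\<close> is
  \<open>rho (s / sqrt 2) u\<close> times a sum of terms depending on \<open>x - u\<close>. Shifting
  \<open>u\<close> and \<open>x\<close> together by an element of 2L changes neither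
  \<open>x - u\<close> nor the membership of \<open>x\<close> and its partner in \<open>c\<close>,
  so the second factor depends on the coset of \<open>u\<close> only.\<close>

lemma gaussian_average_eq:
  assumes L: "is_lattice L" "s > 0" and c: "c \<in> cosets2 L t"
  shows "set_pmf (gaussian_average c s) \<subseteq> shifted L t"
    and "gaussian_average c s = bind_pmf (map_pmf (coset2 L) (gaussian_average c s))
      (\<lambda>d. discrete_gaussian d (s / sqrt 2))"
proof -
  let ?p = "gaussian_average c s" and ?G = "discrete_gaussian c s" and ?s = "s / sqrt 2"
  note G = discrete_gaussian_coset[OF L c]
  show supp: "set_pmf ?p \<subseteq> shifted L t"
  proof
    fix u assume "u \<in> set_pmf ?p"
    then obtain x y where xy: "x \<in> c" "y \<in> c" "u = (x + y) /\<^sub>R 2"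
      by (auto simp: gaussian_average_def G(3))
    then have "y \<in> coset2 L x" using G(4) by auto
    then obtain w where w: "w \<in> L" "y = 2 *\<^sub>R w + x" by (auto simp: coset2_def)
    obtain v where v: "v \<in> L" "x = v - t" using xy G(5) by (auto simp: shifted_def)
    \<comment> \<open>Congruence modulo 2L is what puts the average back into the shifted lattice:
      it is \<open>w + x\<close>.\<close>
    have "x + y = 2 *\<^sub>R (w + x)" by (simp add: w scaleR_add_right scaleR_2)
    then have "u = (w + v) - t" by (simp add: xy v)
    moreover have "w + v \<in> L" by (intro lattice_closed L w v)
    ultimately show "u \<in> shifted L t" unfolding shifted_def by blast
  qed
  show "?p = bind_pmf (map_pmf (coset2 L) ?p) (\<lambda>d. discrete_gaussian d ?s)"
  proof (rule pmf_eq_mixture_of_cosets[OF L(1) _ supp])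
    show "?s > 0" using L by simp
    fix u v assume "coset2 L u = coset2 L v"
    then have "v \<in> coset2 L u" by (simp add: coset2_eq_iff[OF L(1)])
    then obtain w where w: "w \<in> L" "v = 2 *\<^sub>R w + u" by (auto simp: coset2_def)
    have mem: "2 *\<^sub>R w + x \<in> c \<longleftrightarrow> x \<in> c" for x
    proof -
      have "2 *\<^sub>R w + x \<in> coset2 L x" using w by (auto simp: coset2_def)
      then show ?thesis using G(4) by (simp add: coset2_eq_iff[OF L(1)])
    qed
    have pt: "pmf ?G x * pmf ?G (2 *\<^sub>R u - x) * rho ?s v =
      pmf ?G (2 *\<^sub>R w + x) * pmf ?G (2 *\<^sub>R v - (2 *\<^sub>R w + x)) * rho ?s u" for x
    proof (cases "x \<in> c \<and> 2 *\<^sub>R u - x \<in> c")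
      case True
      have eq: "2 *\<^sub>R v - (2 *\<^sub>R w + x) = 2 *\<^sub>R w + (2 *\<^sub>R u - x)"
        by (simp add: w algebra_simps scaleR_2)
      have x: "(2 *\<^sub>R w + x) - v = x - u" by (simp add: w)
      show ?thesis
        using True rho_parallelogram[of s x u] rho_parallelogram[of s "2 *\<^sub>R w + x" v] mem[of "2 *\<^sub>R u - x"] mem[of x]
        unfolding x by (simp add: G(1) eq)
    next
      case False
      have eq: "2 *\<^sub>R v - (2 *\<^sub>R w + x) = 2 *\<^sub>R w + (2 *\<^sub>R u - x)"
        by (simp add: w algebra_simps scaleR_2)
      show ?thesis using False mem[of "2 *\<^sub>R u - x"] mem[of x] by (auto simp: G(1) eq)
    qed
    have bij: "bij_betw (\<lambda>x. 2 *\<^sub>R w + x) UNIV UNIV"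
      by (rule bij_betw_byWitness[where f' = "\<lambda>x. x - 2 *\<^sub>R w"]) auto
    have "ennreal (pmf ?p u * rho ?s v) = (\<integral>\<^sup>+x. ennreal (pmf ?G x) * ennreal (pmf ?G (2 *\<^sub>R u - x)) * ennreal (rho ?s v) \<partial>count_space UNIV)"
      by (simp add: ennreal_mult rho_pos less_imp_le pmf_gaussian_average nn_integral_multc)
    also have "\<dots> = (\<integral>\<^sup>+x. ennreal (pmf ?G (2 *\<^sub>R w + x)) * ennreal (pmf ?G (2 *\<^sub>R v - (2 *\<^sub>R w + x))) * ennreal (rho ?s u) \<partial>count_space UNIV)"
      by (intro nn_integral_cong) (simp only: pt ennreal_mult[symmetric] pmf_nonneg mult_nonneg_nonneg rho_pos less_imp_le)
    also have "\<dots> = (\<integral>\<^sup>+x. ennreal (pmf ?G x) * ennreal (pmf ?G (2 *\<^sub>R v - x)) * ennreal (rho ?s u) \<partial>count_space UNIV)"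
      by (rule nn_integral_bij_count_space[OF bij])
    also have "\<dots> = ennreal (pmf ?p v * rho ?s u)"
      by (simp add: ennreal_mult rho_pos less_imp_le pmf_gaussian_average nn_integral_multc)
    finally show "pmf ?p u * rho ?s v = pmf ?p v * rho ?s u"
      by (simp add: rho_pos less_imp_le)
  qed
qed

section \<open>The chain of coset lists\<close>

text \<open>The transition law depends on the current width, so \<open>s\<close> is carried along
  and shrinks by a factor \<open>sqrt 2\<close> in each round.\<close>

primrec coset_chain :: "(real ^ 'n) set \<Rightarrow> ((real ^ 'n) set list \<Rightarrow> nat set pmf) \<Rightarrow> nat \<Rightarrow> real \<Rightarrow>
    (real ^ 'n) set list \<Rightarrow> (real ^ 'n) set list pmf" where
  "coset_chain L f 0 s cs = return_pmf cs"
| "coset_chain L f (Suc l) s cs = bind_pmf (f cs) (\<lambda>J.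
     bind_pmf (list_pmf (\<lambda>c. map_pmf (coset2 L) (gaussian_average c s)) (pairing (nths cs J)))
       (coset_chain L f l (s / sqrt 2)))"

lemma set_list_pmf_gaussian_average:
  assumes L: "is_lattice L" "s > 0" and cs: "set cs \<subseteq> cosets2 L t"
    and ds: "ds \<in> set_pmf (list_pmf (\<lambda>c. map_pmf (coset2 L) (gaussian_average c s)) cs)"
  shows "set ds \<subseteq> cosets2 L t"
proof -
  have "d \<in> cosets2 L t" if "c \<in> set cs" "d \<in> set_pmf (map_pmf (coset2 L) (gaussian_average c s))" for c d
  proof -
    from that obtain x where "x \<in> set_pmf (gaussian_average c s)" "d = coset2 L x" by auto
    moreover have "set_pmf (gaussian_average c s) \<subseteq> shifted L t"
      using that cs by (intro gaussian_average_eq(1)[OF L]) blast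
    ultimately show ?thesis unfolding cosets2_def by blast
  qed
  moreover have "list_all2 (\<lambda>d c. d \<in> set_pmf (map_pmf (coset2 L) (gaussian_average c s))) ds cs"
    using ds by (simp only: set_list_pmf mem_Collect_eq)
  ultimately show ?thesis
    unfolding list_all2_conv_all_nth by (metis in_set_conv_nth subsetI)
qed

lemma set_pairing_nths: "set cs \<subseteq> A \<Longrightarrow> set (pairing (nths cs J)) \<subseteq> A"
  using set_pairing_subset[of "nths cs J"] set_nths_subset[of cs J] by blast

lemma set_coset_chain:
  assumes "is_lattice L" "s > 0" "set cs \<subseteq> cosets2 L t" "ds \<in> set_pmf (coset_chain L f l s cs)"
  shows "set ds \<subseteq> cosets2 L t"
  using assms
proof (induction l arbitrary: s cs)
  case (Suc l)
  obtain J es where J: "es \<in> set_pmf (list_pmf (\<lambda>c. map_pmf (coset2 L) (gaussian_average c s)) (pairing (nths cs J)))"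
    "ds \<in> set_pmf (coset_chain L f l (s / sqrt 2) es)"
    using Suc.prems(4) by (auto simp only: coset_chain.simps set_bind_pmf UN_iff)
  have "set es \<subseteq> cosets2 L t"
    by (rule set_list_pmf_gaussian_average[OF Suc.prems(1,2) set_pairing_nths[OF Suc.prems(3)] J(1)])
  with Suc.IH[OF Suc.prems(1) _ _ J(2)] Suc.prems(2) show ?case by simp
qed simp

section \<open>Simulating the sieve by cosets, with the vectors drawn at the end\<close>

lemma map_coset2_list_pmf:
  assumes L: "is_lattice L" "s > 0" and cs: "set cs \<subseteq> cosets2 L t"
    and xs: "xs \<in> set_pmf (list_pmf (\<lambda>c. discrete_gaussian c s) cs)"
  shows "map (coset2 L) xs = cs"
proof -
  have "list_all2 (\<lambda>x c. x \<in> set_pmf (discrete_gaussian c s)) xs cs"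
    using xs by (simp only: set_list_pmf mem_Collect_eq)
  then show ?thesis
    using cs
  proof (induction rule: list_all2_induct)
    case (Cons x xs c cs)
    then have c: "c \<in> cosets2 L t" by simp
    with Cons(1) have "coset2 L x = c"
      using discrete_gaussian_coset(3,4)[OF L c] by blast
    with Cons show ?case by simp
  qed simp
qed

text \<open>One round on Gaussian vectors equals a coset transition followed by fresh Gaussian
  vectors of width \<open>s / sqrt 2\<close>, so induction pushes the drawing of vectors past all
  rounds.\<close>

lemma bind_list_pmf_sieve:
  assumes "is_lattice L" "s > 0" "set cs \<subseteq> cosets2 L t"
  shows "bind_pmf (list_pmf (\<lambda>c. discrete_gaussian c s) cs) (sieve L f l) =
    bind_pmf (coset_chain L f l s cs) (list_pmf (\<lambda>c. discrete_gaussian c (s / sqrt 2 ^ l)))"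
  using assms
proof (induction l arbitrary: s cs)
  case 0
  have "sieve L f 0 = return_pmf" by (rule ext) simp
  then show ?case by (simp add: bind_return_pmf bind_return_pmf')
next
  case (Suc l)
  note L = Suc.prems(1,2)
  let ?G = "\<lambda>s. list_pmf (\<lambda>c. discrete_gaussian c s)"
  let ?K = "\<lambda>J. list_pmf (\<lambda>c. map_pmf (coset2 L) (gaussian_average c s)) (pairing (nths cs J))"
  have round: "map_pmf (\<lambda>xs. pair_and_average L (nths xs J)) (?G s cs) = bind_pmf (?K J) (?G (s / sqrt 2))" for J
  proof -
    have sub: "set (nths cs J) \<subseteq> cosets2 L t" using set_nths_subset[of cs J] Suc.prems(3) by blast
    have "map_pmf (\<lambda>xs. pair_and_average L (nths xs J)) (?G s cs) =
      map_pmf (pair_and_average L) (?G s (nths cs J))"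
      by (simp only: map_nths_list_pmf[symmetric] pmf.map_comp o_def)
    also have "\<dots> = list_pmf (\<lambda>c. gaussian_average c s) (pairing (nths cs J))"
      unfolding gaussian_average_def
      using discrete_gaussian_coset(3,4)[OF L] sub
      by (intro map_pair_and_average_list_pmf coset2_eq_iff L) blast
    also have "\<dots> = list_pmf (\<lambda>c. bind_pmf (map_pmf (coset2 L) (gaussian_average c s))
        (\<lambda>d. discrete_gaussian d (s / sqrt 2))) (pairing (nths cs J))"
    proof (rule list_pmf_cong)
      fix c assume "c \<in> set (pairing (nths cs J))"
      then have "c \<in> cosets2 L t" using set_pairing_nths[OF Suc.prems(3)] by blast
      then show "gaussian_average c s = bind_pmf (map_pmf (coset2 L) (gaussian_average c s))
        (\<lambda>d. discrete_gaussian d (s / sqrt 2))" by (rule gaussian_average_eq(2)[OF L])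
    qed
    finally show ?thesis by (simp only: list_pmf_bind)
  qed
  \<comment> \<open>The list of cosets equals \<open>cs\<close> on the whole support, so
    \<open>f\<close> sees a constant argument and \<open>J\<close> may be drawn before the
    vectors.\<close>
  have "bind_pmf (?G s cs) (sieve L f (Suc l)) = bind_pmf (?G s cs) (\<lambda>xs. bind_pmf (f cs)
      (\<lambda>J. sieve L f l (pair_and_average L (nths xs J))))"
    using map_coset2_list_pmf[OF Suc.prems] by (intro bind_pmf_cong) simp_all
  also have "\<dots> = bind_pmf (f cs) (\<lambda>J. bind_pmf (?G s cs)
      (\<lambda>xs. sieve L f l (pair_and_average L (nths xs J))))"
    by (rule bind_commute_pmf)
  also have "\<dots> = bind_pmf (f cs) (\<lambda>J. bind_pmf (bind_pmf (?K J) (?G (s / sqrt 2))) (sieve L f l))"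
    by (simp only: round[symmetric] bind_map_pmf)
  also have "\<dots> = bind_pmf (f cs) (\<lambda>J. bind_pmf (?K J) (\<lambda>ds. bind_pmf (?G (s / sqrt 2) ds) (sieve L f l)))"
    by (simp only: bind_assoc_pmf)
  also have "\<dots> = bind_pmf (f cs) (\<lambda>J. bind_pmf (?K J) (\<lambda>ds. bind_pmf (coset_chain L f l (s / sqrt 2) ds)
      (?G (s / sqrt 2 / sqrt 2 ^ l))))"
  proof (rule bind_pmf_cong[OF refl], rule bind_pmf_cong[OF refl], rule Suc.IH[OF L(1)])
    show "s / sqrt 2 > 0" using L(2) by simp
    show "set ds \<subseteq> cosets2 L t" if "ds \<in> set_pmf (?K J)" for J ds
      by (rule set_list_pmf_gaussian_average[OF L set_pairing_nths[OF Suc.prems(3)] that])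
  qed
  also have "\<dots> = bind_pmf (coset_chain L f (Suc l) s cs) (?G (s / sqrt 2 ^ Suc l))"
    by (simp add: bind_assoc_pmf)
  finally show ?case .
qed

section \<open>Coupling of the two coset chains\<close>

lemma mset_nths_subset: "mset (nths xs J) \<subseteq># mset xs"
proof (induction xs arbitrary: J)
  case (Cons x xs)
  then show ?case
    using Cons.IH[of "{j. Suc j \<in> J}"] by (auto simp: nths_Cons subseteq_mset_def intro: le_SucI)
qed simp

text \<open>Rejection shrinks the left list, pairing is monotone, and the new cosets of the pairs
  common to both sides can be drawn jointly, so the inclusion survives each round.\<close>

lemma rel_coset_chain:
  assumes "mset cs \<subseteq># mset ds"
  shows "rel_pmf (\<lambda>xs ys. mset xs \<subseteq># mset ys) (coset_chain L f l s cs) (coset_chain L accept_all l s ds)"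
  using assms
proof (induction l arbitrary: s cs ds)
  case (Suc l)
  let ?R = "\<lambda>xs ys. mset xs \<subseteq># mset ys"
  have all: "nths ds {..<length ds} = ds" by (simp add: nths_all)
  \<comment> \<open>The right side selects all indices with certainty, so any choice on the left can
    be coupled with it.\<close>
  have "rel_pmf (\<lambda>_ J. J = {..<length ds}) (f cs) (accept_all ds)"
    by (simp add: accept_all_def rel_pmf_return_pmf2)
  then show ?case
    unfolding coset_chain.simps
  proof (rule rel_pmf_bindI, hypsubst, unfold all)
    fix J
    have "mset (pairing (nths cs J)) \<subseteq># mset (pairing ds)"
      using subset_mset.order_trans[OF mset_nths_subset Suc.prems] by (rule pairing_mono)
    then show "rel_pmf ?R
        (bind_pmf (list_pmf (\<lambda>c. map_pmf (coset2 L) (gaussian_average c s)) (pairing (nths cs J)))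
          (coset_chain L f l (s / sqrt 2)))
        (bind_pmf (list_pmf (\<lambda>c. map_pmf (coset2 L) (gaussian_average c s)) (pairing ds))
          (coset_chain L accept_all l (s / sqrt 2)))"
      by (intro rel_pmf_bindI[OF rel_list_pmf_mono] Suc.IH)
  qed
qed (simp add: rel_pmf_return_pmf1)

section \<open>The mixture property and the law of the output\<close>

text \<open>The vectors reveal the coset list they were drawn for. Conditioning on their cosets
  therefore selects one outcome of \<open>\<mu>\<close> and leaves independent draws.\<close>

lemma gaussian_mixture_bind_list_pmf:
  fixes L :: "(real ^ 'n) set"
  assumes L: "is_lattice L" "s > 0" and supp: "\<And>cs. cs \<in> set_pmf \<mu> \<Longrightarrow> set cs \<subseteq> cosets2 L t"
  shows "gaussian_mixture L t s (bind_pmf \<mu> (list_pmf (\<lambda>c. discrete_gaussian c s)))"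
proof -
  let ?G = "list_pmf (\<lambda>c. discrete_gaussian c s)"
  let ?p = "bind_pmf \<mu> ?G"
  have coset: "map (coset2 L) xs = cs" if "cs \<in> set_pmf \<mu>" "xs \<in> set_pmf (?G cs)" for cs xs
    using map_coset2_list_pmf[OF L supp] that by blast
  have sub: "set_pmf ?p \<subseteq> lists (shifted L t)"
  proof
    fix xs assume "xs \<in> set_pmf ?p"
    then obtain cs where cs: "cs \<in> set_pmf \<mu>" "xs \<in> set_pmf (?G cs)" by auto
    have "x \<in> shifted L t" if "x \<in> set xs" for x
    proof -
      have "coset2 L x \<in> set cs" using coset[OF cs] that by auto
      then have "coset2 L x \<in> cosets2 L t" using supp[OF cs(1)] by blast
      then show ?thesis using discrete_gaussian_coset(5)[OF L] coset2_self[OF L(1), of x] by blast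
    qed
    then show "xs \<in> lists (shifted L t)" by auto
  qed
  have "map_pmf (map (coset2 L)) ?p = bind_pmf \<mu> return_pmf"
  proof -
    have "map_pmf (map (coset2 L)) ?p = bind_pmf \<mu> (\<lambda>cs. map_pmf (map (coset2 L)) (?G cs))"
      by (rule map_bind_pmf)
    also have "\<dots> = bind_pmf \<mu> (\<lambda>cs. map_pmf (\<lambda>_. cs) (?G cs))"
      using coset by (intro bind_pmf_cong map_pmf_cong refl)
    finally show ?thesis by (simp add: map_pmf_const)
  qed
  then have push: "map_pmf (map (coset2 L)) ?p = \<mu>" by (simp add: bind_return_pmf')
  show ?thesis
    unfolding gaussian_mixture_def Let_def
  proof (intro conjI ballI impI)
    show "set_pmf ?p \<subseteq> lists (shifted L t)" by (rule sub)
    fix cs assume cs: "cs \<in> lists (cosets2 L t)"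
    let ?E = "{xs. length xs = length cs \<and> (\<forall>i<length cs. xs ! i \<in> cs ! i)}"
    assume pos: "measure_pmf.prob ?p ?E > 0"
    have E: "?E = {xs. map (coset2 L) xs = cs}"
    proof (rule Collect_cong)
      fix xs
      have "xs ! i \<in> cs ! i \<longleftrightarrow> coset2 L (xs ! i) = cs ! i" if "i < length cs" for i
        using that cs by (intro discrete_gaussian_coset(4)[OF L, of _ t]) auto
      then show "length xs = length cs \<and> (\<forall>i<length cs. xs ! i \<in> cs ! i) \<longleftrightarrow> map (coset2 L) xs = cs"
        by (auto simp: list_eq_iff_nth_eq)
    qed
    have probE: "measure_pmf.prob ?p ?E = pmf \<mu> cs"
    proof -
      have "?E = map (coset2 L) -` {cs}" unfolding E by auto
      then have "measure_pmf.prob ?p ?E = measure_pmf.prob (map_pmf (map (coset2 L)) ?p) {cs}"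
        by (simp only: measure_map_pmf)
      then show ?thesis by (simp only: push measure_pmf_single)
    qed
    with pos have mu: "pmf \<mu> cs > 0" by simp
    then have cs_mu: "cs \<in> set_pmf \<mu>" by (simp add: pmf_positive_iff)
    have ne: "set_pmf ?p \<inter> ?E \<noteq> {}"
      using pos measure_pmf_zero_iff[of ?p ?E] by auto
    have cond: "cond_pmf ?p ?E = ?G cs"
    proof (rule pmf_eqI)
      fix xs
      show "pmf (cond_pmf ?p ?E) xs = pmf (?G cs) xs"
      proof (cases "map (coset2 L) xs = cs")
        case True
        have "pmf ?p xs = (\<integral>ds. pmf (?G ds) xs \<partial>\<mu>)" by (rule pmf_bind)
        \<comment> \<open>No parameter list other than \<open>cs\<close> can produce
          \<open>xs\<close>.\<close>
        also have "\<dots> = (\<Sum>ds\<in>{cs}. pmf (?G ds) xs * pmf \<mu> ds)"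
        proof (rule integral_measure_pmf_real)
          fix ds assume ds: "ds \<in> set_pmf \<mu>" "pmf (?G ds) xs \<noteq> 0"
          then have "xs \<in> set_pmf (?G ds)" by (simp only: set_pmf_iff not_False_eq_True)
          then show "ds \<in> {cs}" using coset[OF ds(1)] True by simp
        qed simp
        finally have "pmf ?p xs = pmf (?G cs) xs * pmf \<mu> cs" by simp
        moreover have "xs \<in> ?E" using True unfolding E by simp
        ultimately show ?thesis using mu by (simp only: pmf_cond[OF ne] probE if_True) simp
      next
        case False
        then have "xs \<notin> set_pmf (?G cs)" using coset[OF cs_mu] by blast
        then have "pmf (?G cs) xs = 0" by (simp only: set_pmf_iff not_not)
        moreover have "xs \<notin> ?E" using False unfolding E by simp
        ultimately show ?thesis by (simp only: pmf_cond[OF ne] if_False)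
      qed
    qed
    show "prob_space.indep_vars (measure_pmf (cond_pmf ?p ?E)) (\<lambda>_. count_space UNIV)
        (\<lambda>i xs. xs ! i) {..<length cs}"
      unfolding cond by (rule indep_vars_list_pmf)
    show "\<forall>i<length cs. map_pmf (\<lambda>xs. xs ! i) (cond_pmf ?p ?E) = discrete_gaussian (cs ! i) s"
      unfolding cond by (simp add: map_nth_list_pmf)
  qed
qed

text \<open>The input is itself a mixture over cosets, so the simulation applies from the start. The
  law \<open>\<nu>\<close> of the initial cosets does not involve \<open>f\<close>, so two runs can
  share them.\<close>

lemma sieve_output_eq:
  fixes L :: "(real ^ 'n) set" and t :: "real ^ 'n" and s :: real and M :: nat
  assumes L: "is_lattice L" "s > 0"
  defines "\<nu> \<equiv> replicate_pmf M (map_pmf (coset2 L) (discrete_gaussian (shifted L t) s))"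
  shows "sieve_output L t s M f l = bind_pmf (bind_pmf \<nu> (coset_chain L f l s))
      (list_pmf (\<lambda>c. discrete_gaussian c (s / sqrt 2 ^ l)))"
    and "cs \<in> set_pmf \<nu> \<Longrightarrow> set cs \<subseteq> cosets2 L t"
proof -
  let ?D = "discrete_gaussian (shifted L t) s"
  have R: "rho s summable_on shifted L t" "shifted L t \<noteq> {}"
    using rho_summable_on_shifted[OF L] lattice_closed(1)[OF L(1)] by (auto simp: shifted_def)
  show *: "set cs \<subseteq> cosets2 L t" if "cs \<in> set_pmf \<nu>" for cs
    using that by (auto simp: \<nu>_def set_replicate_pmf set_discrete_gaussian[OF R] cosets2_def)
  have "?D = bind_pmf (map_pmf (coset2 L) ?D) (\<lambda>c. discrete_gaussian c s)"
  proof (rule pmf_eq_mixture_of_cosets[OF L])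
    show "set_pmf ?D \<subseteq> shifted L t" by (simp add: set_discrete_gaussian[OF R])
    fix u v assume "coset2 L u = coset2 L v"
    then have uv: "u \<in> coset2 L v" "v \<in> coset2 L u" by (simp_all add: coset2_eq_iff[OF L(1)])
    have "u \<in> shifted L t \<longleftrightarrow> v \<in> shifted L t"
      using coset2_subset_shifted[OF L(1)] uv by blast
    then show "pmf ?D u * rho s v = pmf ?D v * rho s u"
      by (simp add: pmf_discrete_gaussian(1)[OF R])
  qed
  then have "replicate_pmf M ?D = replicate_pmf M (bind_pmf (map_pmf (coset2 L) ?D) (\<lambda>c. discrete_gaussian c s))"
    by simp
  \<comment> \<open>The entries are identically distributed, so dummy parameters of type
    \<open>unit\<close> suffice.\<close>
  also have "\<dots> = bind_pmf \<nu> (list_pmf (\<lambda>c. discrete_gaussian c s))"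
    by (simp only: replicate_pmf_eq_list_pmf[where x = "()"] \<nu>_def list_pmf_bind)
  finally have "sieve_output L t s M f l =
      bind_pmf \<nu> (\<lambda>cs. bind_pmf (list_pmf (\<lambda>c. discrete_gaussian c s) cs) (sieve L f l))"
    by (simp only: sieve_output_def bind_assoc_pmf)
  also have "\<dots> = bind_pmf \<nu> (\<lambda>cs. bind_pmf (coset_chain L f l s cs)
      (list_pmf (\<lambda>c. discrete_gaussian c (s / sqrt 2 ^ l))))"
    using * by (intro bind_pmf_cong refl bind_list_pmf_sieve L)
  finally show "sieve_output L t s M f l = bind_pmf (bind_pmf \<nu> (coset_chain L f l s))
      (list_pmf (\<lambda>c. discrete_gaussian c (s / sqrt 2 ^ l)))"
    by (simp only: bind_assoc_pmf)
qed

section \<open>Comparison of probabilities through the coupling\<close>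

lemma rel_pmf_prob_mono:
  assumes "rel_pmf R p q" "\<And>x y. R x y \<Longrightarrow> x \<in> A \<Longrightarrow> y \<in> B"
  shows "measure_pmf.prob p A \<le> measure_pmf.prob q B"
proof -
  have "measure_pmf.prob p A \<le> measure_pmf.prob q {y. \<exists>x\<in>A. R x y}"
    by (rule rel_pmf_measureD[OF assms(1)])
  also have "\<dots> \<le> measure_pmf.prob q B"
    using assms(2) by (intro measure_pmf.finite_measure_mono) auto
  finally show ?thesis .
qed

lemma card_nth_eq_count_mset: "card {j. j < length xs \<and> xs ! j = i} = count (mset xs) i"
  by (simp add: count_mset count_list_eq_length_filter length_filter_conv_card eq_commute)

theorem theorem3p4:
  fixes L :: "(real ^ 'n) set" and t :: "real ^ 'n" and s :: real and l M :: nat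
    and f :: "(real ^ 'n) set list \<Rightarrow> nat set pmf"
  assumes "is_lattice L" and "s > 0" and "l \<ge> 1" and "M \<ge> 2"
    and "rejection_function L t f"
  shows "gaussian_mixture L t (s / 2 powr (real l / 2)) (sieve_output L t s M f l) \<and>
    gaussian_mixture L t (s / 2 powr (real l / 2)) (sieve_output L t s M accept_all l) \<and>
    mixture_dominates L t (sieve_output L t s M accept_all l) (sieve_output L t s M f l) \<and>
    (\<forall>S. finite S \<and> S \<subseteq> shifted L t \<longrightarrow>
       measure_pmf.prob (sieve_output L t s M f l) {xs. S \<subseteq> set xs} \<le>
       measure_pmf.prob (sieve_output L t s M accept_all l) {xs. S \<subseteq> set xs})"
proof -
  note L = assms(1,2)
  have "(2::real) powr (real l / 2) = (2 powr (1 / 2)) powr real l"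
    by (simp add: powr_powr)
  also have "\<dots> = sqrt 2 ^ l"
    by (simp add: powr_half_sqrt powr_realpow)
  finally have width: "s / 2 powr (real l / 2) = s / sqrt 2 ^ l" by simp
  have mixture: "gaussian_mixture L t (s / 2 powr (real l / 2)) (sieve_output L t s M h l)" for h
    unfolding sieve_output_eq(1)[OF L] width
  proof (rule gaussian_mixture_bind_list_pmf[OF L(1)])
    show "s / sqrt 2 ^ l > 0" using L(2) by simp
    fix cs assume "cs \<in> set_pmf (bind_pmf (replicate_pmf M (map_pmf (coset2 L) (discrete_gaussian (shifted L t) s)))
      (coset_chain L h l s))"
    then show "set cs \<subseteq> cosets2 L t"
      by (simp only: set_bind_pmf UN_iff) (blast dest: sieve_output_eq(2)[OF L] set_coset_chain[OF L])
  qed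
  \<comment> \<open>Both runs start from the same cosets; the inclusion then passes through the
    chains and through the final Gaussian draws.\<close>
  have coupling: "rel_pmf (\<lambda>xs ys. mset xs \<subseteq># mset ys) (sieve_output L t s M f l) (sieve_output L t s M accept_all l)"
    unfolding sieve_output_eq(1)[OF L]
    by (intro rel_pmf_bindI[where R = "\<lambda>xs ys. mset xs \<subseteq># mset ys"] rel_list_pmf_mono rel_coset_chain
          rel_pmf_reflI) simp_all
  have "mixture_dominates L t (sieve_output L t s M accept_all l) (sieve_output L t s M f l)"
    unfolding mixture_dominates_def dominates_def coset_distribution_def card_nth_eq_count_mset measure_map_pmf
  proof
    fix k :: "(real ^ 'n) set \<Rightarrow> nat"
    show "measure_pmf.prob (sieve_output L t s M f l)
        (map (coset2 L) -` {xs. \<forall>i\<in>cosets2 L t. k i \<le> count (mset xs) i}) \<le>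
      measure_pmf.prob (sieve_output L t s M accept_all l)
        (map (coset2 L) -` {xs. \<forall>i\<in>cosets2 L t. k i \<le> count (mset xs) i})"
    proof (rule rel_pmf_prob_mono[OF coupling])
      fix xs ys :: "(real ^ 'n) list"
      assume "mset xs \<subseteq># mset ys"
      then have "mset (map (coset2 L) xs) \<subseteq># mset (map (coset2 L) ys)"
        by (simp add: image_mset_subseteq_mono)
      then have le: "count (mset (map (coset2 L) xs)) i \<le> count (mset (map (coset2 L) ys)) i" for i
        by (rule mset_subset_eq_count)
      assume "xs \<in> map (coset2 L) -` {xs. \<forall>i\<in>cosets2 L t. k i \<le> count (mset xs) i}"
      then show "ys \<in> map (coset2 L) -` {xs. \<forall>i\<in>cosets2 L t. k i \<le> count (mset xs) i}"
        using le by (auto intro: order_trans simp del: mset_map)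
    qed
  qed
  \<comment> \<open>The coupling compares the vectors themselves, not just their cosets, so it gives
    this inequality directly.\<close>
  moreover have "measure_pmf.prob (sieve_output L t s M f l) {xs. S \<subseteq> set xs} \<le>
       measure_pmf.prob (sieve_output L t s M accept_all l) {xs. S \<subseteq> set xs}" for S
  proof (rule rel_pmf_prob_mono[OF coupling])
    fix xs ys :: "(real ^ 'n) list"
    assume "mset xs \<subseteq># mset ys"
    then have "set xs \<subseteq> set ys" using set_mset_mono by fastforce
    then show "xs \<in> {xs. S \<subseteq> set xs} \<Longrightarrow> ys \<in> {xs. S \<subseteq> set xs}" by blast
  qed
  ultimately show ?thesis using mixture by blast
qed

end
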